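(* Let $(\mathcal{X},\mathcal{F})$ be a measurable space with a filtration $(\mathcal{F}_n)_{n\ge 0}$, let $\mathbb{P}$ be a probability measure on it, consider the simple hypothesis $H=\{\mathbb{P}\}$ and fix a level $\alpha>0$. If $(\phi_n)_{n\ge0}$ is an admissible anytime valid sequential test, then there exists an $\mathcal{F}$-measurable test $\phi:\mathcal{X}\to[0,1]$ such that $\phi_n=\mathbb{E}^{\mathbb{P}}[\phi\mid\mathcal{F}_n]$, $\mathbb{P}$-almost surely, for every $n\ge0$.
   Context: $(\mathcal{F}_n)_{n\ge0}$ is a filtration with $\mathcal{F}_n\subseteq\mathcal{F}$ and $\mathcal{F}_0=\{\emptyset,\mathcal{X}\}$. A test is an $\mathcal{F}$-measurable map into $[0,1]$. A sequential test is a sequence of tests $(\phi_n)_{n\ge0}$ adapted to $(\mathcal{F}_n)$; it is anytime valid (for $\{\mathbb{P}\}$ at level $\alpha$) if $\mathbb{E}^{\mathbb{P}}[\phi_\tau]\le\alpha$ for every (possibly infinite) stopping time $\tau$ with respect to $(\mathcal{F}_n)$, where $\phi_\infty:=\limsup_{n\to\infty}\phi_n$. An anytime valid sequential test $(\phi_n)$ is admissible if there exists no other anytime valid sequential test $(\phi_n')$ (at the same level) such that $\mathbb{P}(\phi_n'\ge\phi_n)=1$ for all $n$ and $\mathbb{P}(\phi_n'>\phi_n)>0$ for some $n$. *)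

theory Defs
  imports "HOL-Probability.Probability"
begin

definition is_test :: "'a measure \<Rightarrow> ('a \<Rightarrow> real) \<Rightarrow> bool" where
  "is_test M \<phi> \<longleftrightarrow> \<phi> \<in> borel_measurable M \<and> (\<forall>x\<in>space M. 0 \<le> \<phi> x \<and> \<phi> x \<le> 1)"

definition sequential_test ::
  "'a measure \<Rightarrow> (nat \<Rightarrow> 'a measure) \<Rightarrow> (nat \<Rightarrow> 'a \<Rightarrow> real) \<Rightarrow> bool" where
  "sequential_test M F \<phi> \<longleftrightarrow>
     (\<forall>n. is_test M (\<phi> n)) \<and> (\<forall>n. \<phi> n \<in> borel_measurable (F n))"

text \<open>The library's \<^const>\<open>stopping_time\<close> takes its values in the index type of the filtration,
  so it does not cover possibly infinite stopping times of a filtration indexed by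
  the natural numbers. On finite-valued times the two notions agree, see below.\<close>

definition extended_stopping_time :: "(nat \<Rightarrow> 'a measure) \<Rightarrow> ('a \<Rightarrow> enat) \<Rightarrow> bool" where
  "extended_stopping_time F \<tau> \<longleftrightarrow> (\<forall>n. Measurable.pred (F n) (\<lambda>x. \<tau> x \<le> enat n))"

lemma extended_stopping_time_enat:
  "extended_stopping_time F (\<lambda>x. enat (T x)) \<longleftrightarrow> stopping_time F T"
  by (simp add: extended_stopping_time_def stopping_time_def)

text \<open>The limes superior is taken in the extended reals because \<^typ>\<open>real\<close> is not a complete
  lattice; for a sequence in the unit interval it is again a number in the unit interval, so the
  conversion back is faithful.\<close>

definition stopped_test :: "(nat \<Rightarrow> 'a \<Rightarrow> real) \<Rightarrow> ('a \<Rightarrow> enat) \<Rightarrow> 'a \<Rightarrow> real" where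
  "stopped_test \<phi> \<tau> x =
     (case \<tau> x of enat n \<Rightarrow> \<phi> n x | \<infinity> \<Rightarrow> real_of_ereal (limsup (\<lambda>n. ereal (\<phi> n x))))"

definition anytime_valid ::
  "'a measure \<Rightarrow> (nat \<Rightarrow> 'a measure) \<Rightarrow> real \<Rightarrow> (nat \<Rightarrow> 'a \<Rightarrow> real) \<Rightarrow> bool" where
  "anytime_valid M F \<alpha> \<phi> \<longleftrightarrow>
     sequential_test M F \<phi> \<and>
     (\<forall>\<tau>. extended_stopping_time F \<tau> \<longrightarrow> (\<integral>x. stopped_test \<phi> \<tau> x \<partial>M) \<le> \<alpha>)"

definition admissible ::
  "'a measure \<Rightarrow> (nat \<Rightarrow> 'a measure) \<Rightarrow> real \<Rightarrow> (nat \<Rightarrow> 'a \<Rightarrow> real) \<Rightarrow> bool" where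
  "admissible M F \<alpha> \<phi> \<longleftrightarrow>
     anytime_valid M F \<alpha> \<phi> \<and>
     \<not> (\<exists>\<phi>'. anytime_valid M F \<alpha> \<phi>' \<and>
            (\<forall>n. measure M {x \<in> space M. \<phi>' n x \<ge> \<phi> n x} = 1) \<and>
            (\<exists>n. measure M {x \<in> space M. \<phi>' n x > \<phi> n x} > 0))"

text \<open>The integrand in \<^const>\<open>anytime_valid\<close> is itself a test, so the Bochner integral there is
  the genuine expectation and not the default value for non-integrable functions.\<close>

lemma is_test_stopped_test:
  assumes sub: "\<And>n. subalgebra M (F n)"
    and phi: "sequential_test M F \<phi>"
    and tau: "extended_stopping_time F \<tau>"
  shows "is_test M (stopped_test \<phi> \<tau>)"
proof -
  have meas [measurable]: "\<phi> n \<in> borel_measurable M" for n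
    using phi by (simp add: sequential_test_def is_test_def)
  have le: "Measurable.pred M (\<lambda>x. \<tau> x \<le> enat n)" for n
    using tau sub[of n] by (auto simp: extended_stopping_time_def intro: measurable_from_subalg)
  have fin: "Measurable.pred M (\<lambda>x. \<tau> x = enat n)" for n
  proof (cases n)
    case 0
    then have "(\<lambda>x. \<tau> x = enat n) = (\<lambda>x. \<tau> x \<le> enat 0)"
      by (auto simp: zero_enat_def[symmetric])
    then show ?thesis using le[of 0] by metis
  next
    case (Suc m)
    have "(\<lambda>x. \<tau> x = enat n) = (\<lambda>x. \<tau> x \<le> enat (Suc m) \<and> \<not> \<tau> x \<le> enat m)"
    proof
      show "(\<tau> x = enat n) = (\<tau> x \<le> enat (Suc m) \<and> \<not> \<tau> x \<le> enat m)" for x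
        using Suc by (cases "\<tau> x") auto
    qed
    moreover have "Measurable.pred M (\<lambda>x. \<tau> x \<le> enat (Suc m) \<and> \<not> \<tau> x \<le> enat m)"
      using le[of m] le[of "Suc m"] by (intro pred_intros_logic)
    ultimately show ?thesis by metis
  qed
  have inf: "Measurable.pred M (\<lambda>x. \<tau> x = \<infinity>)"
  proof -
    have "(\<lambda>x. \<tau> x = \<infinity>) = (\<lambda>x. \<forall>n. \<not> \<tau> x \<le> enat n)"
    proof
      show "(\<tau> x = \<infinity>) = (\<forall>n. \<not> \<tau> x \<le> enat n)" for x
        by (cases "\<tau> x") auto
    qed
    moreover have "Measurable.pred M (\<lambda>x. \<forall>n. \<not> \<tau> x \<le> enat n)"
      using le by (intro pred_intros_countable pred_intros_logic)
    ultimately show ?thesis by metis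
  qed
  have tau_meas: "\<tau> \<in> measurable M (count_space UNIV)"
  proof (subst measurable_count_space_eq_countable, simp, safe)
    fix a :: enat
    have "Measurable.pred M (\<lambda>x. \<tau> x = a)"
      using fin inf by (cases a) simp_all
    moreover have "\<tau> -` {a} \<inter> space M = {x \<in> space M. \<tau> x = a}"
      by blast
    ultimately show "\<tau> -` {a} \<inter> space M \<in> sets M"
      by (simp only: pred_def)
  qed auto
  have lim: "0 \<le> real_of_ereal (limsup (\<lambda>n. ereal (\<phi> n x)))
      \<and> real_of_ereal (limsup (\<lambda>n. ereal (\<phi> n x))) \<le> 1" if "x \<in> space M" for x
  proof -
    have bd: "0 \<le> \<phi> n x \<and> \<phi> n x \<le> 1" for n
      using phi that by (simp add: sequential_test_def is_test_def)
    have "0 \<le> limsup (\<lambda>n. ereal (\<phi> n x))"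
      using bd by (intro le_Limsup) auto
    moreover have "limsup (\<lambda>n. ereal (\<phi> n x)) \<le> 1"
      using bd by (intro Limsup_bounded) auto
    ultimately show ?thesis
      by (cases "limsup (\<lambda>n. ereal (\<phi> n x))") auto
  qed
  have "(\<lambda>x. (case a of enat n \<Rightarrow> \<phi> n x | \<infinity> \<Rightarrow> real_of_ereal (limsup (\<lambda>n. ereal (\<phi> n x)))))
      \<in> borel_measurable M" for a
    by (cases a) auto
  then have "stopped_test \<phi> \<tau> \<in> borel_measurable M"
    unfolding stopped_test_def
    by (rule measurable_compose_countable'[where g = \<tau> and I = UNIV]) (simp_all add: tau_meas)
  moreover have "0 \<le> stopped_test \<phi> \<tau> x \<and> stopped_test \<phi> \<tau> x \<le> 1" if "x \<in> space M" for x
    using phi that lim[OF that]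
    by (cases "\<tau> x") (auto simp: stopped_test_def sequential_test_def is_test_def)
  ultimately show ?thesis
    by (simp add: is_test_def)
qed

end

theory Submission
  imports Defs
begin

text \<open>The representing test is \<open>\<psi> = \<phi>\<^sub>\<infinity> = limsup \<phi>\<^sub>n\<close> itself. Everything rests on one
  device: change an admissible \<open>\<phi>\<close> at a single time \<open>n\<close>, replacing \<open>\<phi>\<^sub>n\<close> by some larger test \<open>g\<close>.
  The limes superior does not see such a change, so validity of the new sequence can be checked by
  comparing its value at a stopping time with the value of the old sequence at another stopping
  time; and if the new sequence is valid, admissibility forces \<open>g = \<phi>\<^sub>n\<close> almost surely
  (\<open>admissible_fun_upd_eq\<close>). The device is used twice.

  First, let \<open>\<sigma> \<ge> n\<close> be a possibly infinite stopping time and raise \<open>\<phi>\<^sub>n\<close> to \<open>E[\<phi>\<^sub>\<sigma> | F\<^sub>n]\<close> wherever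
  the latter is larger. Whoever stops at \<open>n\<close> where the value was raised could have continued to
  \<open>\<sigma>\<close> instead with the same expected reward from the old sequence, so the new sequence is valid.
  Hence \<open>E[\<phi>\<^sub>\<sigma> | F\<^sub>n] \<le> \<phi>\<^sub>n\<close> (\<open>admissible_cond_exp_stopped_le\<close>): \<open>\<phi>\<close> is a supermartingale, with
  optional stopping including the time \<open>\<infinity>\<close>.

  Second, the inequality \<open>E[\<phi>\<^sub>n\<^sub>+\<^sub>1 | F\<^sub>n] \<le> \<phi>\<^sub>n\<close> is an equality (\<open>admissible_cond_exp_Suc\<close>), since
  otherwise \<open>\<phi>\<^sub>n\<^sub>+\<^sub>1\<close> could be raised, by a convex combination with 1, until its conditional
  expectation is \<open>\<phi>\<^sub>n\<close>. The raised sequence is still valid: from time \<open>n\<close> on, no stopping rule earns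
  more than \<open>\<phi>\<^sub>n\<close> in conditional expectation, so stopping at \<open>\<tau>\<close> is no better than stopping the old
  sequence at \<open>min \<tau> n\<close>.

  So \<open>\<phi>\<close> is a martingale, and it is closed by its limes superior: \<open>E[\<psi> | F\<^sub>n] \<le> \<phi>\<^sub>n\<close> is the first
  step with \<open>\<sigma> = \<infinity>\<close>, and the reverse Fatou lemma (\<open>set_integral_fatou_limsup\<close>) gives the other
  inequality on every event of \<open>F\<^sub>n\<close>.\<close>

section \<open>Stopping times and stopped tests\<close>

locale filtered_prob_space = prob_space M + filtration "space M" F
  for M :: "'a measure" and F :: "nat \<Rightarrow> 'a measure" +
  assumes subalgebra_F: "subalgebra M (F n)"
begin

lemma sigma_finite_subalgebra_F: "sigma_finite_subalgebra M (F n)"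
proof -
  interpret finite_measure_subalgebra M "F n"
    by unfold_locales (rule subalgebra_F)
  show ?thesis ..
qed

lemma sets_F_subset: "A \<in> sets (F n) \<Longrightarrow> A \<in> sets M"
  using subalgebra_F[of n] by (auto simp: subalgebra_def)

lemma is_test_integrable: "is_test M f \<Longrightarrow> integrable M f"
  by (intro integrable_const_bound[where B = 1]) (auto simp: is_test_def)

lemma is_test_set_integrable:
  "is_test M f \<Longrightarrow> A \<in> sets M \<Longrightarrow> set_integrable M A f"
  unfolding set_integrable_def by (rule integrable_mult_indicator[OF _ is_test_integrable])

lemma is_test_integral_split:
  assumes f: "is_test M f" and A: "A \<in> sets M"
  shows "(\<integral>x. f x \<partial>M) = (LINT x:A|M. f x) + (LINT x:space M - A|M. f x)"
proof -
  have "A \<union> (space M - A) = space M"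
    using sets.sets_into_space[OF A] by auto
  then have "(\<integral>x. f x \<partial>M) = (LINT x:A \<union> (space M - A)|M. f x)"
    using set_integral_space[OF is_test_integrable[OF f]] by simp
  also have "\<dots> = (LINT x:A|M. f x) + (LINT x:space M - A|M. f x)"
    by (rule set_integral_Un) (auto intro: is_test_set_integrable f A)
  finally show ?thesis .
qed

lemma stopping_le_sets:
  assumes "extended_stopping_time F \<tau>" "m \<le> n"
  shows "{x \<in> space M. \<tau> x \<le> enat m} \<in> sets (F n)"
  using assms sets_F_mono[of m n]
  by (auto simp: extended_stopping_time_def pred_def space_F)

lemma stopping_gt_sets:
  assumes "extended_stopping_time F \<tau>"
  shows "{x \<in> space M. enat n < \<tau> x} \<in> sets (F n)"
proof -
  have "{x \<in> space M. enat n < \<tau> x} = space (F n) - {x \<in> space M. \<tau> x \<le> enat n}"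
    by (auto simp: space_F)
  then show ?thesis
    using stopping_le_sets[OF assms order_refl] by (metis sets.compl_sets)
qed

lemma stopping_eq_sets:
  assumes \<tau>: "extended_stopping_time F \<tau>"
  shows "{x \<in> space M. \<tau> x = enat n} \<in> sets (F n)"
proof (cases n)
  case 0
  then have "{x \<in> space M. \<tau> x = enat n} = {x \<in> space M. \<tau> x \<le> enat n}"
    by (auto simp: zero_enat_def[symmetric])
  then show ?thesis
    using stopping_le_sets[OF \<tau>, of n n] by simp
next
  case (Suc m)
  have "{x \<in> space M. \<tau> x = enat n}
      = {x \<in> space M. \<tau> x \<le> enat n} - {x \<in> space M. \<tau> x \<le> enat m}"
  proof -
    have "\<tau> x = enat n \<longleftrightarrow> \<tau> x \<le> enat n \<and> \<not> \<tau> x \<le> enat m" for x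
      using Suc by (cases "\<tau> x") auto
    then show ?thesis by auto
  qed
  then show ?thesis
    using stopping_le_sets[OF \<tau>, of n n] stopping_le_sets[OF \<tau>, of m n] Suc by auto
qed

lemma extended_stopping_timeI:
  assumes "\<And>n. {x \<in> space M. \<tau> x \<le> enat n} \<in> sets (F n)"
  shows "extended_stopping_time F \<tau>"
  using assms by (simp add: extended_stopping_time_def pred_def space_F)

lemma extended_stopping_time_const: "extended_stopping_time F (\<lambda>x. c)"
  by (simp add: extended_stopping_time_def)

lemma extended_stopping_time_min:
  "extended_stopping_time F \<sigma> \<Longrightarrow> extended_stopping_time F \<tau> \<Longrightarrow>
    extended_stopping_time F (\<lambda>x. min (\<sigma> x) (\<tau> x))"
  by (auto simp: extended_stopping_time_def min_le_iff_disj intro!: pred_intros_logic)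

lemma extended_stopping_time_max:
  "extended_stopping_time F \<sigma> \<Longrightarrow> extended_stopping_time F \<tau> \<Longrightarrow>
    extended_stopping_time F (\<lambda>x. max (\<sigma> x) (\<tau> x))"
  by (auto simp: extended_stopping_time_def intro!: pred_intros_logic)

text \<open>The event of switching belongs to \<open>F\<^sub>n\<close>, and \<open>\<sigma>\<close> does not stop before \<open>n\<close>; hence before time
  \<open>n\<close> the switched time agrees with \<open>\<tau>\<close>, and from \<open>n\<close> on it is already known which of the two
  applies.\<close>

lemma extended_stopping_time_switch:
  assumes \<tau>: "extended_stopping_time F \<tau>" and \<sigma>: "extended_stopping_time F \<sigma>"
    and ge: "\<And>x. enat n \<le> \<sigma> x" and B: "B \<in> sets (F n)"
  shows "extended_stopping_time F (\<lambda>x. if \<tau> x = enat n \<and> x \<in> B then \<sigma> x else \<tau> x)"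
    (is "extended_stopping_time F ?\<rho>")
proof (rule extended_stopping_timeI)
  fix m
  show "{x \<in> space M. ?\<rho> x \<le> enat m} \<in> sets (F m)"
  proof (cases "m < n")
    case True
    have "\<not> \<sigma> x \<le> enat m" for x
      using ge[of x] True by (meson enat_ord_simps(1) leD order_trans)
    then have "{x \<in> space M. ?\<rho> x \<le> enat m} = {x \<in> space M. \<tau> x \<le> enat m}"
      using True by auto
    then show ?thesis
      using stopping_le_sets[OF \<tau>, of m m] by simp
  next
    case False
    define C where "C = {x \<in> space M. \<tau> x = enat n} \<inter> B"
    have "C \<in> sets (F m)"
      using stopping_eq_sets[OF \<tau>, of n] B sets_F_mono[of n m] False by (auto simp: C_def)
    moreover have "{x \<in> space M. ?\<rho> x \<le> enat m}
        = (C \<inter> {x \<in> space M. \<sigma> x \<le> enat m}) \<union> ({x \<in> space M. \<tau> x \<le> enat m} - C)"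
      by (auto simp: C_def split: if_splits)
    ultimately show ?thesis
      using stopping_le_sets[OF \<tau>, of m m] stopping_le_sets[OF \<sigma>, of m m] by auto
  qed
qed

text \<open>The value at time \<open>\<infinity>\<close> stays the same, because changing one term does not affect a
  limes superior.\<close>

lemma stopped_test_fun_upd:
  "stopped_test (\<phi>(n := g)) \<tau> x = (if \<tau> x = enat n then g x else stopped_test \<phi> \<tau> x)"
proof -
  have "limsup (\<lambda>m. ereal ((\<phi>(n := g)) m x)) = limsup (\<lambda>m. ereal (\<phi> m x))"
    by (rule Limsup_eq, rule eventually_mono[OF eventually_gt_at_top[of n]]) auto
  then show ?thesis
    by (simp add: stopped_test_def split: enat.split)
qed

text \<open>This is the reverse Fatou lemma with the constant 1 as dominating function. Its library
  form concerns \<^typ>\<open>ennreal\<close>, so the work consists in identifying the limes superior there with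
  the one that defines the stopped test.\<close>

lemma set_integral_fatou_limsup:
  assumes f: "\<And>k. is_test M (f k)" and A: "A \<in> sets M"
    and lim: "is_test M (stopped_test f (\<lambda>_. \<infinity>))"
    and c: "\<And>k. n \<le> k \<Longrightarrow> c \<le> (LINT x:A|M. f k x)"
  shows "c \<le> (LINT x:A|M. stopped_test f (\<lambda>_. \<infinity>) x)"
proof -
  let ?\<psi> = "stopped_test f (\<lambda>_. \<infinity>)"
  have [measurable]: "f k \<in> borel_measurable M" for k
    using f by (simp add: is_test_def)
  have [measurable]: "A \<in> sets M" by (fact A)
  have f01: "0 \<le> f k x" "f k x \<le> 1" if "x \<in> space M" for k x
    using f that by (auto simp: is_test_def)
  have nn: "(\<integral>\<^sup>+ x. ennreal (indicator A x * h x) \<partial>M) = ennreal (LINT x:A|M. h x)"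
    if "is_test M h" for h
  proof -
    have "(\<integral>\<^sup>+ x. ennreal (indicator A x * h x) \<partial>M) = ennreal (LINT x|M. indicator A x * h x)"
      using is_test_set_integrable[OF that A] that
      by (intro nn_integral_eq_integral) (auto simp: set_integrable_def is_test_def)
    then show ?thesis
      by (simp add: set_lebesgue_integral_def)
  qed
  have lims: "limsup (\<lambda>k. ennreal (indicator A x * f k x)) = ennreal (indicator A x * ?\<psi> x)"
    if x: "x \<in> space M" for x
  proof (cases "x \<in> A")
    case True
    have bd: "0 \<le> limsup (\<lambda>k. ereal (f k x))" "limsup (\<lambda>k. ereal (f k x)) \<le> 1"
      using f01[OF x] by (auto intro: le_Limsup Limsup_bounded)
    have "limsup (\<lambda>k. e2ennreal (ereal (f k x))) = e2ennreal (limsup (\<lambda>k. ereal (f k x)))"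
      by (rule Limsup_compose_continuous_mono)
        (auto simp: mono_def intro: continuous_on_e2ennreal e2ennreal_mono)
    also have "\<dots> = ennreal (?\<psi> x)"
      using bd by (cases "limsup (\<lambda>k. ereal (f k x))")
        (auto simp: stopped_test_def e2ennreal_ereal)
    finally show ?thesis
      using True by (simp add: e2ennreal_ereal)
  qed (simp add: Limsup_const)
  have "ennreal c \<le> limsup (\<lambda>k. \<integral>\<^sup>+ x. ennreal (indicator A x * f k x) \<partial>M)"
    by (rule le_Limsup)
      (auto simp: nn f eventually_at_top_linorder intro!: exI[of _ n] ennreal_leI c)
  also have "\<dots> \<le> (\<integral>\<^sup>+ x. limsup (\<lambda>k. ennreal (indicator A x * f k x)) \<partial>M)"
  proof (rule nn_integral_limsup[where w = "\<lambda>_. 1"])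
    show "AE x in M. ennreal (indicator A x * f k x) \<le> 1" for k
      using f01 by (auto simp: indicator_def)
  qed (auto simp: emeasure_space_1)
  also have "\<dots> = (\<integral>\<^sup>+ x. ennreal (indicator A x * ?\<psi> x) \<partial>M)"
    by (rule nn_integral_cong) (rule lims)
  also have "\<dots> = ennreal (LINT x:A|M. ?\<psi> x)"
    by (rule nn[OF lim])
  finally have "ennreal c \<le> ennreal (LINT x:A|M. ?\<psi> x)" .
  moreover have "0 \<le> (LINT x:A|M. ?\<psi> x)"
    unfolding set_lebesgue_integral_def
    using lim by (intro integral_nonneg_AE) (auto simp: is_test_def)
  ultimately show ?thesis
    by (simp add: ennreal_le_iff)
qed

section \<open>Consequences of admissibility\<close>

lemma sequential_test_fun_upd:
  assumes seq: "sequential_test M F \<phi>" and g: "g \<in> borel_measurable (F n)"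
    and le: "\<And>x. x \<in> space M \<Longrightarrow> \<phi> n x \<le> g x" and le1: "\<And>x. x \<in> space M \<Longrightarrow> g x \<le> 1"
  shows "sequential_test M F (\<phi>(n := g))"
proof -
  have "0 \<le> g x" if "x \<in> space M" for x
  proof -
    have "0 \<le> \<phi> n x"
      using seq that by (simp add: sequential_test_def is_test_def)
    then show ?thesis
      using le[OF that] by linarith
  qed
  then show ?thesis
    using seq g le1 measurable_from_subalg[OF subalgebra_F g]
    by (simp add: sequential_test_def is_test_def)
qed

text \<open>For a modification at a single time that only increases values, the competitor condition in
  \<^const>\<open>admissible\<close> reduces to validity.\<close>

lemma admissible_fun_upd_eq:
  assumes adm: "admissible M F \<alpha> \<phi>"
    and g: "g \<in> borel_measurable (F n)"
    and le: "\<And>x. x \<in> space M \<Longrightarrow> \<phi> n x \<le> g x" and le1: "\<And>x. x \<in> space M \<Longrightarrow> g x \<le> 1"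
    and valid: "\<And>\<tau>. extended_stopping_time F \<tau> \<Longrightarrow>
      (\<integral>x. stopped_test (\<phi>(n := g)) \<tau> x \<partial>M) \<le> \<alpha>"
  shows "AE x in M. g x = \<phi> n x"
proof -
  have seq: "sequential_test M F \<phi>"
    using adm by (simp add: admissible_def anytime_valid_def)
  then have [measurable]: "\<phi> m \<in> borel_measurable M" for m
    by (simp add: sequential_test_def is_test_def)
  have [measurable]: "g \<in> borel_measurable M"
    using g by (rule measurable_from_subalg[OF subalgebra_F])
  have "sequential_test M F (\<phi>(n := g))"
    by (rule sequential_test_fun_upd[OF seq g le le1])
  then have "anytime_valid M F \<alpha> (\<phi>(n := g))"
    using valid by (simp add: anytime_valid_def)
  moreover have "measure M {x \<in> space M. \<phi> m x \<le> (\<phi>(n := g)) m x} = 1" for m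
  proof -
    have "{x \<in> space M. \<phi> m x \<le> (\<phi>(n := g)) m x} = space M"
      using le by auto
    then show ?thesis by (simp add: prob_space)
  qed
  ultimately have "\<not> (\<exists>m. measure M {x \<in> space M. \<phi> m x < (\<phi>(n := g)) m x} > 0)"
    using adm unfolding admissible_def by blast
  then have "\<not> measure M {x \<in> space M. \<phi> n x < (\<phi>(n := g)) n x} > 0"
    by blast
  then have "prob {x \<in> space M. \<phi> n x < g x} = 0"
    using measure_nonneg[of M "{x \<in> space M. \<phi> n x < g x}"] by (simp only: fun_upd_same)
  then have "AE x in M. \<not> \<phi> n x < g x"
    by (subst (asm) prob_eq_0) auto
  then show ?thesis
    using AE_space by eventually_elim (use le in force)
qed

text \<open>If the conditional expectation \<open>e\<close> of \<open>\<phi>\<^sub>\<sigma>\<close> exceeds \<open>\<phi>\<^sub>n\<close> on \<open>B \<in> F\<^sub>n\<close>, let \<open>g\<close> be \<open>\<phi>\<^sub>n\<close> raised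
  to \<open>e\<close> there. Stopping the modified sequence at \<open>\<tau>\<close> is then no better than stopping the original
  one at \<open>\<rho>\<close>, which passes from \<open>\<tau>\<close> to \<open>\<sigma>\<close> on \<open>C = {\<tau> = n} \<inter> B\<close>: the integral of \<open>e\<close> over
  \<open>C \<in> F\<^sub>n\<close> is that of \<open>\<phi>\<^sub>\<sigma>\<close>. So the modification is valid, and admissibility rules out \<open>B\<close> up to a
  null set. The time \<open>\<sigma> = \<infinity>\<close> is allowed, which is what lets the limes superior close the
  martingale in the end.\<close>

lemma admissible_cond_exp_stopped_le:
  assumes adm: "admissible M F \<alpha> \<phi>"
    and \<sigma>: "extended_stopping_time F \<sigma>" and ge: "\<And>x. enat n \<le> \<sigma> x"
  shows "AE x in M. real_cond_exp M (F n) (stopped_test \<phi> \<sigma>) x \<le> \<phi> n x"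
proof -
  interpret sigma_finite_subalgebra M "F n" by (rule sigma_finite_subalgebra_F)
  have seq: "sequential_test M F \<phi>"
    using adm by (simp add: admissible_def anytime_valid_def)
  have test: "is_test M (stopped_test \<phi> \<tau>)" if "extended_stopping_time F \<tau>" for \<tau>
    using is_test_stopped_test[OF subalgebra_F seq that] .
  define e where "e = real_cond_exp M (F n) (stopped_test \<phi> \<sigma>)"
  define B where "B = {x \<in> space M. \<phi> n x < e x}"
  \<comment> \<open>A conditional expectation is determined, and hence at most 1, only almost surely;
    the minimum with 1 keeps \<open>g\<close> a test at every point.\<close>
  define g where "g x = max (\<phi> n x) (min 1 (e x))" for x
  have [measurable]: "\<phi> n \<in> borel_measurable (F n)"
    using seq by (simp add: sequential_test_def)
  have [measurable]: "e \<in> borel_measurable (F n)"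
    by (simp add: e_def)
  have "{x \<in> space (F n). \<phi> n x < e x} \<in> sets (F n)" by measurable
  then have B: "B \<in> sets (F n)" by (simp add: B_def space_F)
  have g: "g \<in> borel_measurable (F n)"
    unfolding g_def[abs_def] by measurable
  have ge_\<phi>: "\<phi> n x \<le> g x" for x
    by (simp add: g_def)
  have le1: "g x \<le> 1" if "x \<in> space M" for x
    using seq that by (auto simp: g_def sequential_test_def is_test_def)
  have seq': "sequential_test M F (\<phi>(n := g))"
    by (rule sequential_test_fun_upd[OF seq g ge_\<phi> le1])
  have "AE x in M. g x = \<phi> n x"
  proof (rule admissible_fun_upd_eq[OF adm g ge_\<phi> le1])
    fix \<tau> assume \<tau>: "extended_stopping_time F \<tau>"
    define \<rho> where "\<rho> x = (if \<tau> x = enat n \<and> x \<in> B then \<sigma> x else \<tau> x)" for x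
    define C where "C = {x \<in> space M. \<tau> x = enat n} \<inter> B"
    have \<rho>: "extended_stopping_time F \<rho>"
      unfolding \<rho>_def[abs_def] by (rule extended_stopping_time_switch[OF \<tau> \<sigma> ge B])
    have C: "C \<in> sets (F n)"
      using stopping_eq_sets[OF \<tau>] B by (auto simp: C_def)
    note CM = sets_F_subset[OF C]
    have test': "is_test M (stopped_test (\<phi>(n := g)) \<tau>)"
      by (rule is_test_stopped_test[OF subalgebra_F seq' \<tau>])
    have "(LINT x:C|M. stopped_test (\<phi>(n := g)) \<tau> x) \<le> (LINT x:C|M. e x)"
    proof (rule set_integral_mono)
      show "set_integrable M C e"
        unfolding set_integrable_def e_def
        by (rule integrable_mult_indicator[OF CM
            real_cond_exp_int(1)[OF is_test_integrable[OF test[OF \<sigma>]]]])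
      show "stopped_test (\<phi>(n := g)) \<tau> x \<le> e x" if "x \<in> C" for x
        using that by (auto simp: stopped_test_fun_upd C_def B_def g_def)
    qed (rule is_test_set_integrable[OF test' CM])
    also have "\<dots> = (LINT x:C|M. stopped_test \<phi> \<sigma> x)"
      unfolding e_def
      by (rule real_cond_exp_intA[OF is_test_integrable[OF test[OF \<sigma>]] C, symmetric])
    also have "\<dots> = (LINT x:C|M. stopped_test \<phi> \<rho> x)"
      using CM by (intro set_lebesgue_integral_cong) (auto simp: \<rho>_def C_def stopped_test_def)
    finally have on_C: "(LINT x:C|M. stopped_test (\<phi>(n := g)) \<tau> x)
        \<le> (LINT x:C|M. stopped_test \<phi> \<rho> x)" .
    have off_C: "(LINT x:space M - C|M. stopped_test (\<phi>(n := g)) \<tau> x)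
        = (LINT x:space M - C|M. stopped_test \<phi> \<rho> x)"
    proof (rule set_lebesgue_integral_cong[OF sets.compl_sets[OF CM]], intro allI impI)
      fix x assume "x \<in> space M - C"
      then have "stopped_test (\<phi>(n := g)) \<tau> x = stopped_test \<phi> \<tau> x" "\<rho> x = \<tau> x"
        by (auto simp: stopped_test_fun_upd \<rho>_def C_def B_def g_def stopped_test_def[of \<phi>])
      then show "stopped_test (\<phi>(n := g)) \<tau> x = stopped_test \<phi> \<rho> x"
        by (simp add: stopped_test_def)
    qed
    have "(\<integral>x. stopped_test (\<phi>(n := g)) \<tau> x \<partial>M) \<le> (\<integral>x. stopped_test \<phi> \<rho> x \<partial>M)"
      using on_C off_C
      by (simp add: is_test_integral_split[OF test' CM] is_test_integral_split[OF test[OF \<rho>] CM])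
    also have "\<dots> \<le> \<alpha>"
      using adm \<rho> by (simp add: admissible_def anytime_valid_def)
    finally show "(\<integral>x. stopped_test (\<phi>(n := g)) \<tau> x \<partial>M) \<le> \<alpha>" .
  qed
  moreover have "AE x in M. e x \<le> 1"
    unfolding e_def
  proof (rule real_cond_exp_le_c[OF is_test_integrable[OF test[OF \<sigma>]]])
    show "AE x in M. stopped_test \<phi> \<sigma> x \<le> 1"
      using test[OF \<sigma>] by (intro AE_I2) (simp add: is_test_def)
  qed
  ultimately show ?thesis
    unfolding e_def[symmetric]
  proof eventually_elim
    fix x assume "g x = \<phi> n x" "e x \<le> 1"
    then show "e x \<le> \<phi> n x"
      using max.cobounded2[of "min 1 (e x)" "\<phi> n x"] by (simp add: g_def)
  qed
qed

lemma admissible_set_integral_stopped_le: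
  assumes adm: "admissible M F \<alpha> \<phi>"
    and \<sigma>: "extended_stopping_time F \<sigma>" and ge: "\<And>x. enat n \<le> \<sigma> x"
    and A: "A \<in> sets (F n)"
  shows "(LINT x:A|M. stopped_test \<phi> \<sigma> x) \<le> (LINT x:A|M. \<phi> n x)"
proof -
  interpret sigma_finite_subalgebra M "F n" by (rule sigma_finite_subalgebra_F)
  have seq: "sequential_test M F \<phi>"
    using adm by (simp add: admissible_def anytime_valid_def)
  have int: "integrable M (stopped_test \<phi> \<sigma>)" "integrable M (\<phi> n)"
    using is_test_integrable is_test_stopped_test[OF subalgebra_F seq \<sigma>] seq
    by (auto simp: sequential_test_def)
  have "(LINT x:A|M. stopped_test \<phi> \<sigma> x)
      = (LINT x:A|M. real_cond_exp M (F n) (stopped_test \<phi> \<sigma>) x)"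
    by (rule real_cond_exp_intA[OF int(1) A])
  also have "\<dots> \<le> (LINT x:A|M. \<phi> n x)"
  proof (rule set_integral_mono_AE)
    show "set_integrable M A (real_cond_exp M (F n) (stopped_test \<phi> \<sigma>))"
      unfolding set_integrable_def
      by (rule integrable_mult_indicator[OF sets_F_subset[OF A] real_cond_exp_int(1)[OF int(1)]])
    show "set_integrable M A (\<phi> n)"
      unfolding set_integrable_def
      by (rule integrable_mult_indicator[OF sets_F_subset[OF A] int(2)])
    show "AE x\<in>A in M. real_cond_exp M (F n) (stopped_test \<phi> \<sigma>) x \<le> \<phi> n x"
      using admissible_cond_exp_stopped_le[OF adm \<sigma> ge] by eventually_elim simp
  qed
  finally show ?thesis .
qed

text \<open>A test can be raised until its conditional expectation equals any prescribed larger
  \<open>b \<le> 1\<close>: with \<open>e = E[f | F\<^sub>n]\<close>, the convex combination \<open>f + l (1 - f)\<close> with \<open>F\<^sub>n\<close>-measurable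
  weight \<open>l\<close> has conditional expectation \<open>e + l (1 - e)\<close>, so \<open>l = (b - e) / (1 - e)\<close> is the
  right weight.\<close>

lemma cond_exp_raise_to:
  assumes f: "is_test M f" and b: "b \<in> borel_measurable (F n)"
    and le: "AE x in M. real_cond_exp M (F n) f x \<le> b x" and b1: "AE x in M. b x \<le> 1"
  obtains l where "l \<in> borel_measurable (F n)" "\<And>x. 0 \<le> l x" "\<And>x. l x \<le> 1"
    "AE x in M. real_cond_exp M (F n) (\<lambda>x. f x + l x * (1 - f x)) x = b x"
proof
  interpret sigma_finite_subalgebra M "F n" by (rule sigma_finite_subalgebra_F)
  define e where "e = real_cond_exp M (F n) f"
  \<comment> \<open>The truncation acts on a null set only and yields bounds at every point. Where \<open>e x = 1\<close>,
    the quotient is 0 by convention, which is correct as then \<open>b x = 1\<close> almost surely.\<close>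
  define l where "l x = max 0 (min 1 ((b x - e x) / (1 - e x)))" for x
  have [measurable]: "e \<in> borel_measurable (F n)" "b \<in> borel_measurable (F n)"
    using b by (simp_all add: e_def)
  show l: "l \<in> borel_measurable (F n)"
    unfolding l_def[abs_def] by measurable
  show l01: "0 \<le> l x" "l x \<le> 1" for x
    by (simp_all add: l_def)
  have fM[measurable]: "f \<in> borel_measurable M" and f01: "\<And>x. x \<in> space M \<Longrightarrow> 0 \<le> f x \<and> f x \<le> 1"
    using f by (auto simp: is_test_def)
  have [measurable]: "l \<in> borel_measurable M"
    using l by (rule measurable_from_subalg[OF subalgebra_F])
  have intf: "integrable M f" by (rule is_test_integrable[OF f])
  have intl: "integrable M (\<lambda>x. l x * (1 - f x))"
  proof (rule integrable_const_bound[where B = 1])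
    show "AE x in M. norm (l x * (1 - f x)) \<le> 1"
    proof (rule AE_I2)
      fix x assume "x \<in> space M"
      then show "norm (l x * (1 - f x)) \<le> 1"
        using f01[of x] l01[of x] by (auto simp: abs_mult intro!: mult_le_one)
    qed
  qed measurable
  have "AE x in M. real_cond_exp M (F n) (\<lambda>x. f x + l x * (1 - f x)) x
      = e x + real_cond_exp M (F n) (\<lambda>x. l x * (1 - f x)) x"
    unfolding e_def by (rule real_cond_exp_add[OF intf intl])
  moreover have "AE x in M. real_cond_exp M (F n) (\<lambda>x. l x * (1 - f x)) x
      = l x * real_cond_exp M (F n) (\<lambda>x. 1 - f x) x"
    by (rule real_cond_exp_mult[OF l _ intl]) measurable
  moreover have "AE x in M. real_cond_exp M (F n) (\<lambda>x. 1 - f x) x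
      = real_cond_exp M (F n) (\<lambda>x. 1) x - e x"
    unfolding e_def by (rule real_cond_exp_diff) (auto intro: intf)
  moreover have "AE x in M. real_cond_exp M (F n) (\<lambda>x. 1) x = 1"
    by (rule real_cond_exp_F_meas) auto
  moreover have "AE x in M. e x \<le> b x"
    using le by (simp add: e_def)
  ultimately show "AE x in M. real_cond_exp M (F n) (\<lambda>x. f x + l x * (1 - f x)) x = b x"
    using b1
  proof eventually_elim
    fix x
    assume eq: "real_cond_exp M (F n) (\<lambda>x. f x + l x * (1 - f x)) x
        = e x + real_cond_exp M (F n) (\<lambda>x. l x * (1 - f x)) x"
      "real_cond_exp M (F n) (\<lambda>x. l x * (1 - f x)) x = l x * real_cond_exp M (F n) (\<lambda>x. 1 - f x) x"
      "real_cond_exp M (F n) (\<lambda>x. 1 - f x) x = real_cond_exp M (F n) (\<lambda>x. 1) x - e x"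
      "real_cond_exp M (F n) (\<lambda>x. 1) x = 1"
      and le: "e x \<le> b x" "b x \<le> 1"
    have "e x + l x * (1 - e x) = b x"
    proof (cases "e x = 1")
      case False
      then have "l x = (b x - e x) / (1 - e x)"
        using le by (simp add: l_def field_simps)
      then show ?thesis using False by simp
    qed (use le in simp)
    then show "real_cond_exp M (F n) (\<lambda>x. f x + l x * (1 - f x)) x = b x"
      using eq by simp
  qed
qed

text \<open>Raise \<open>\<phi>\<^sub>n\<^sub>+\<^sub>1\<close> to a test \<open>h\<close> with \<open>E[h | F\<^sub>n] = \<phi>\<^sub>n\<close>. To see that this keeps the sequence valid,
  split the event \<open>A = {\<tau> > n} \<in> F\<^sub>n\<close> into \<open>E = {\<tau> = n + 1}\<close> and \<open>D = {\<tau> > n + 1}\<close>. On \<open>E\<close> the stopped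
  value is \<open>h\<close>. On \<open>D\<close> it is the old one, whose integral is at most that of \<open>\<phi>\<^sub>n\<^sub>+\<^sub>1\<close> by the
  supermartingale property, hence at most that of \<open>h\<close>. Together the integral over \<open>A\<close> is at most
  that of \<open>h\<close>, which is that of \<open>\<phi>\<^sub>n\<close>. Hence stopping at \<open>\<tau>\<close> is no better than stopping the old
  sequence at \<open>min \<tau> n\<close>, and admissibility gives \<open>h = \<phi>\<^sub>n\<^sub>+\<^sub>1\<close>.\<close>

lemma admissible_cond_exp_Suc:
  assumes adm: "admissible M F \<alpha> \<phi>"
  shows "AE x in M. real_cond_exp M (F n) (\<phi> (Suc n)) x = \<phi> n x"
proof -
  interpret sigma_finite_subalgebra M "F n" by (rule sigma_finite_subalgebra_F)
  have seq: "sequential_test M F \<phi>"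
    using adm by (simp add: admissible_def anytime_valid_def)
  have t: "is_test M (\<phi> m)" and meas: "\<phi> m \<in> borel_measurable (F m)" for m
    using seq by (auto simp: sequential_test_def)
  have b: "0 \<le> \<phi> m x" "\<phi> m x \<le> 1" if "x \<in> space M" for m x
    using t[of m] that by (auto simp: is_test_def)
  have test: "is_test M (stopped_test \<phi> \<tau>)" if "extended_stopping_time F \<tau>" for \<tau>
    using is_test_stopped_test[OF subalgebra_F seq that] .
  have "stopped_test \<phi> (\<lambda>_. enat (Suc n)) = \<phi> (Suc n)"
    by (simp add: stopped_test_def fun_eq_iff)
  then have le: "AE x in M. real_cond_exp M (F n) (\<phi> (Suc n)) x \<le> \<phi> n x"
    using admissible_cond_exp_stopped_le[OF adm extended_stopping_time_const[of "enat (Suc n)"], of n]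
    by simp
  have "AE x in M. \<phi> n x \<le> 1"
    by (rule AE_I2) (rule b)
  then obtain l where l: "l \<in> borel_measurable (F n)" and l01: "\<And>x. 0 \<le> l x" "\<And>x. l x \<le> 1"
    and eq: "AE x in M. real_cond_exp M (F n) (\<lambda>x. \<phi> (Suc n) x + l x * (1 - \<phi> (Suc n) x)) x = \<phi> n x"
    by (rule cond_exp_raise_to[OF t[of "Suc n"] meas[of n] le]) blast
  define h where "h x = \<phi> (Suc n) x + l x * (1 - \<phi> (Suc n) x)" for x
  have [measurable]: "\<phi> (Suc n) \<in> borel_measurable (F (Suc n))" by (rule meas)
  have [measurable]: "l \<in> borel_measurable (F (Suc n))"
    by (rule measurable_from_subalg[OF _ l])
      (use sets_F_mono[of n "Suc n"] in \<open>simp add: subalgebra_def space_F\<close>)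
  have h: "h \<in> borel_measurable (F (Suc n))"
    unfolding h_def[abs_def] by measurable
  have ge: "\<phi> (Suc n) x \<le> h x" if "x \<in> space M" for x
    using b[OF that, of "Suc n"] l01[of x] by (simp add: h_def)
  have le1: "h x \<le> 1" if "x \<in> space M" for x
  proof -
    have "l x * (1 - \<phi> (Suc n) x) \<le> 1 * (1 - \<phi> (Suc n) x)"
      using b[OF that, of "Suc n"] l01[of x] by (intro mult_right_mono) auto
    then show ?thesis by (simp add: h_def)
  qed
  have seq': "sequential_test M F (\<phi>(Suc n := h))"
    by (rule sequential_test_fun_upd[OF seq h ge le1])
  then have th: "is_test M h"
    unfolding sequential_test_def by (metis fun_upd_same)
  have "AE x in M. h x = \<phi> (Suc n) x"
  proof (rule admissible_fun_upd_eq[OF adm h ge le1])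
    fix \<tau> assume \<tau>: "extended_stopping_time F \<tau>"
    define A where "A = {x \<in> space M. enat n < \<tau> x}"
    define D where "D = {x \<in> space M. enat (Suc n) < \<tau> x}"
    define E where "E = {x \<in> space M. \<tau> x = enat (Suc n)}"
    have A: "A \<in> sets (F n)" and D: "D \<in> sets (F (Suc n))" and E: "E \<in> sets (F (Suc n))"
      unfolding A_def D_def E_def by (rule stopping_gt_sets[OF \<tau>] stopping_eq_sets[OF \<tau>])+
    note sets_M [measurable] = sets_F_subset[OF A] sets_F_subset[OF D] sets_F_subset[OF E]
    have DE: "D \<union> E = A" "D \<inter> E = {}"
    proof -
      have "enat n < \<tau> x \<longleftrightarrow> enat (Suc n) < \<tau> x \<or> \<tau> x = enat (Suc n)" for x
        by (cases "\<tau> x") auto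
      then show "D \<union> E = A" "D \<inter> E = {}"
        by (auto simp: A_def D_def E_def)
    qed
    let ?\<phi>' = "\<phi>(Suc n := h)"
    have test': "is_test M (stopped_test ?\<phi>' \<tau>)"
      using is_test_stopped_test[OF subalgebra_F seq' \<tau>] .
    have D_le: "(LINT x:D|M. stopped_test \<phi> \<tau> x) \<le> (LINT x:D|M. h x)"
    proof -
      \<comment> \<open>The maximum does not change \<open>\<tau>\<close> on \<open>D\<close>, and makes it a stopping time that is at least
        \<open>n + 1\<close> everywhere.\<close>
      have "(LINT x:D|M. stopped_test \<phi> \<tau> x)
          = (LINT x:D|M. stopped_test \<phi> (\<lambda>x. max (\<tau> x) (enat (Suc n))) x)"
        by (rule set_lebesgue_integral_cong[OF sets_M(2)]) (auto simp: D_def stopped_test_def max_def)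
      also have "\<dots> \<le> (LINT x:D|M. \<phi> (Suc n) x)"
        by (rule admissible_set_integral_stopped_le[OF adm _ _ D])
          (auto intro: extended_stopping_time_max \<tau> extended_stopping_time_const)
      also have "\<dots> \<le> (LINT x:D|M. h x)"
        by (rule set_integral_mono)
          (use sets.sets_into_space[OF sets_M(2)] in \<open>auto intro: is_test_set_integrable sets_M(2) t th ge\<close>)
      finally show ?thesis .
    qed
    have E_eq: "(LINT x:E|M. stopped_test ?\<phi>' \<tau> x) = (LINT x:E|M. h x)"
      by (rule set_lebesgue_integral_cong[OF sets_M(3)]) (auto simp: E_def stopped_test_fun_upd)
    have D_eq: "(LINT x:D|M. stopped_test ?\<phi>' \<tau> x) = (LINT x:D|M. stopped_test \<phi> \<tau> x)"
      by (rule set_lebesgue_integral_cong[OF sets_M(2)]) (auto simp: D_def stopped_test_fun_upd)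
    have "(LINT x:A|M. stopped_test ?\<phi>' \<tau> x)
        = (LINT x:D|M. stopped_test ?\<phi>' \<tau> x) + (LINT x:E|M. stopped_test ?\<phi>' \<tau> x)"
      unfolding DE(1)[symmetric]
      by (rule set_integral_Un) (auto intro: is_test_set_integrable sets_M test' simp: DE)
    also have "\<dots> \<le> (LINT x:D|M. h x) + (LINT x:E|M. h x)"
      using D_le by (simp add: D_eq E_eq)
    also have "\<dots> = (LINT x:A|M. h x)"
      unfolding DE(1)[symmetric]
      by (rule set_integral_Un[symmetric]) (auto intro: is_test_set_integrable sets_M th simp: DE)
    also have "\<dots> = (LINT x:A|M. real_cond_exp M (F n) h x)"
      by (rule real_cond_exp_intA[OF is_test_integrable[OF th] A])
    also have "\<dots> = (LINT x:A|M. \<phi> n x)"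
    proof (rule set_lebesgue_integral_cong_AE)
      show "AE x in M. x \<in> A \<longrightarrow> real_cond_exp M (F n) h x = \<phi> n x"
        using eq unfolding h_def[abs_def] by eventually_elim simp
    qed (use t[of n] in \<open>auto simp: is_test_def\<close>)
    also have "\<dots> = (LINT x:A|M. stopped_test \<phi> (\<lambda>x. min (\<tau> x) (enat n)) x)"
      by (rule set_lebesgue_integral_cong[OF sets_M(1)]) (auto simp: A_def stopped_test_def min_def)
    finally have A_le: "(LINT x:A|M. stopped_test ?\<phi>' \<tau> x)
        \<le> (LINT x:A|M. stopped_test \<phi> (\<lambda>x. min (\<tau> x) (enat n)) x)" .
    have Ac: "(LINT x:space M - A|M. stopped_test ?\<phi>' \<tau> x)
        = (LINT x:space M - A|M. stopped_test \<phi> (\<lambda>x. min (\<tau> x) (enat n)) x)"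
      by (rule set_lebesgue_integral_cong[OF sets.compl_sets[OF sets_M(1)]])
        (auto simp: A_def stopped_test_fun_upd stopped_test_def[of \<phi>] min_def not_less)
    have min: "extended_stopping_time F (\<lambda>x. min (\<tau> x) (enat n))"
      by (intro extended_stopping_time_min \<tau> extended_stopping_time_const)
    have "(\<integral>x. stopped_test ?\<phi>' \<tau> x \<partial>M) \<le> (\<integral>x. stopped_test \<phi> (\<lambda>x. min (\<tau> x) (enat n)) x \<partial>M)"
      using A_le Ac
      by (simp add: is_test_integral_split[OF test' sets_M(1)]
          is_test_integral_split[OF test[OF min] sets_M(1)])
    also have "\<dots> \<le> \<alpha>"
      using adm min by (simp add: admissible_def anytime_valid_def)
    finally show "(\<integral>x. stopped_test ?\<phi>' \<tau> x \<partial>M) \<le> \<alpha>" .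
  qed
  then have "AE x in M. real_cond_exp M (F n) h x = real_cond_exp M (F n) (\<phi> (Suc n)) x"
    by (rule real_cond_exp_cong) (use th t[of "Suc n"] in \<open>simp_all add: is_test_def\<close>)
  then show ?thesis
    using eq unfolding h_def[abs_def] by eventually_elim simp
qed

lemma admissible_set_integral_eq:
  assumes adm: "admissible M F \<alpha> \<phi>" and A: "A \<in> sets (F n)" and "n \<le> k"
  shows "(LINT x:A|M. \<phi> k x) = (LINT x:A|M. \<phi> n x)"
  using \<open>n \<le> k\<close>
proof (induction rule: dec_induct)
  case (step k)
  interpret sigma_finite_subalgebra M "F k" by (rule sigma_finite_subalgebra_F)
  have t: "is_test M (\<phi> m)" for m
    using adm by (simp add: admissible_def anytime_valid_def sequential_test_def)
  have A': "A \<in> sets (F k)"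
    using A sets_F_mono[OF step.hyps(1)] by auto
  have "(LINT x:A|M. \<phi> (Suc k) x) = (LINT x:A|M. real_cond_exp M (F k) (\<phi> (Suc k)) x)"
    by (rule real_cond_exp_intA[OF is_test_integrable[OF t] A'])
  also have "\<dots> = (LINT x:A|M. \<phi> k x)"
  proof (rule set_lebesgue_integral_cong_AE)
    show "AE x in M. x \<in> A \<longrightarrow> real_cond_exp M (F k) (\<phi> (Suc k)) x = \<phi> k x"
      using admissible_cond_exp_Suc[OF adm, of k] by eventually_elim simp
  qed (use t[of k] sets_F_subset[OF A] in \<open>auto simp: is_test_def\<close>)
  finally show ?case using step.IH by simp
qed simp

end

section \<open>The limiting test\<close>

theorem proposition2:
  fixes M :: "'a measure" and F :: "nat \<Rightarrow> 'a measure"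
    and \<alpha> :: real and \<phi> :: "nat \<Rightarrow> 'a \<Rightarrow> real"
  assumes "prob_space M"
    and "filtration (space M) F"
    and "\<And>n. subalgebra M (F n)"
    and "sets (F 0) = {{}, space M}"
    and "\<alpha> > 0"
    and "admissible M F \<alpha> \<phi>"
  shows "\<exists>\<psi>. is_test M \<psi> \<and> (\<forall>n. AE x in M. \<phi> n x = real_cond_exp M (F n) \<psi> x)"
proof -
  interpret filtered_prob_space M F
    using assms(1-3) by (intro filtered_prob_space.intro filtered_prob_space_axioms.intro)
  note adm = \<open>admissible M F \<alpha> \<phi>\<close>
  have seq: "sequential_test M F \<phi>"
    using adm by (simp add: admissible_def anytime_valid_def)
  then have t: "is_test M (\<phi> m)" and meas: "\<phi> m \<in> borel_measurable (F m)" for m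
    by (auto simp: sequential_test_def)
  define \<psi> where "\<psi> = stopped_test \<phi> (\<lambda>_. \<infinity>)"
  have test: "is_test M \<psi>"
    unfolding \<psi>_def by (rule is_test_stopped_test[OF subalgebra_F seq extended_stopping_time_const])
  have "AE x in M. real_cond_exp M (F n) \<psi> x = \<phi> n x" for n
  proof -
    interpret sigma_finite_subalgebra M "F n" by (rule sigma_finite_subalgebra_F)
    show ?thesis
    proof (rule real_cond_exp_charact)
      fix A assume A: "A \<in> sets (F n)"
      show "(LINT x:A|M. \<psi> x) = (LINT x:A|M. \<phi> n x)"
      proof (rule antisym)
        show "(LINT x:A|M. \<psi> x) \<le> (LINT x:A|M. \<phi> n x)"
          unfolding \<psi>_def
          by (rule admissible_set_integral_stopped_le[OF adm extended_stopping_time_const _ A]) simp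
        show "(LINT x:A|M. \<phi> n x) \<le> (LINT x:A|M. \<psi> x)"
          unfolding \<psi>_def
          by (rule set_integral_fatou_limsup[OF t sets_F_subset[OF A] test[unfolded \<psi>_def]])
            (rule eq_refl[OF admissible_set_integral_eq[OF adm A, symmetric]])
      qed
    qed (rule is_test_integrable[OF test] is_test_integrable[OF t] meas)+
  qed
  then have "AE x in M. \<phi> n x = real_cond_exp M (F n) \<psi> x" for n
    by (rule AE_symmetric)
  with test show ?thesis
    by (intro exI[of _ \<psi>] conjI allI)
qed

end
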